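(* Let $A_1,\ldots,A_N\in\mathbb{R}^{n\times n}$ with $N\ge 2$ and let $\tau\ge 1$ be an integer. The following statements are equivalent: (a) There exist matrices $P_i\in\mathbb{S}^n_{\succ0}$, $i=1,\ldots,N$, such that $$A_i^\prime P_iA_i-P_i\prec0\quad\text{and}\quad (A_i^{\prime})^{\tau}P_iA_i^\tau-P_j\prec0$$ hold for all $i,j=1,\ldots,N$, $i\ne j$. (b) There exist matrix sequences $R_i:\{0,\ldots,\tau\}\to\mathbb{S}^n$, $R_i(0)\succ0$, $i=1,\ldots,N$, and a scalar $\varepsilon>0$ such that $$A_i^{\prime}R_i(\tau)A_i-R_i(\tau)\prec0,$$ $$A_i^\prime R_i(k+1)A_i-R_i(k)\preceq0,$$ $$R_i(0)-R_j(\tau)+\varepsilon I\preceq0$$ hold for all $i,j=1,\ldots,N$, $i\ne j$ and $k=0,\ldots,\tau-1$. (c) There exist matrix sequences $S_i:\{0,\ldots,\tau\}\to\mathbb{S}^n$, $S_i(\tau)\succ0$, $i=1,\ldots,N$, and a scalar $\varepsilon>0$ such that $$A_iS_i(\tau)A_i^{\prime}-S_i(\tau)\prec0,$$ $$A_iS_i(k)A_i^{\prime}-S_i(k+1)\preceq0,$$ $$S_j(\tau)-S_i(0)+\varepsilon I\preceq0$$ hold for all $i,j=1,\ldots,N$, $i\ne j$ and $k=0,\ldots,\tau-1$. Moreover, when one of the equivalent statements (a), (b), (c) holds, the switched system $x(t+1)=A_{\sigma(t)}x(t)$, $x(t_0)=x_0$, is asymptotically stable for all switching-time sequences $\{\phi_q\}_{q\in\mathbb{N}}$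 satisfying $\tau_q\ge\tau$ for all $q$.
   Context: $\mathbb{S}^n$ denotes the set of real symmetric $n\times n$ matrices and $\mathbb{S}^n_{\succ0}$ the set of positive definite ones. For symmetric $A,B$, $A\succ B$ (resp. $A\succeq B$) means $A-B$ is positive definite (resp. positive semidefinite); $\prec,\preceq$ are the reversed relations. $A^\prime$ is the transpose of $A$. Switched system: the state is $x(t)\in\mathbb{R}^n$, and the switching signal is $\sigma:\mathbb{N}\to\{1,\ldots,N\}$, where $N$ is the number of subsystems. The switching instants $\{\phi_q\}_{q\in\mathbb{N}}$ are the instants at which $\sigma(t)$ changes value, with the convention $\phi_0=0$; $\sigma$ is constant on $\{\phi_q,\ldots,\phi_{q+1}-1\}$. The dwell-times are $\tau_q:=\phi_{q+1}-\phi_q$. *)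

theory Defs
  imports "HOL-Analysis.Analysis" "HOL-Library.Extended_Nat"
begin

definition pos_def :: "real^'n^'n \<Rightarrow> bool" where
  "pos_def X \<longleftrightarrow> transpose X = X \<and> (\<forall>v. v \<noteq> 0 \<longrightarrow> v \<bullet> (X *v v) > 0)"

definition pos_semidef :: "real^'n^'n \<Rightarrow> bool" where
  "pos_semidef X \<longleftrightarrow> transpose X = X \<and> (\<forall>v. v \<bullet> (X *v v) \<ge> 0)"

(* The orders on type vec are componentwise and the plain \<prec> is taken by the library for
   cardinalities, so the Loewner order gets its own symbols.
   As symmetry is part of pos_def, 0 \<prec>\<^sub>L X includes that X is symmetric. *)
definition loewner_less :: "real^'n^'n \<Rightarrow> real^'n^'n \<Rightarrow> bool" (infix \<open>\<prec>\<^sub>L\<close> 50) where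
  "X \<prec>\<^sub>L Y \<longleftrightarrow> pos_def (Y - X)"

definition loewner_le :: "real^'n^'n \<Rightarrow> real^'n^'n \<Rightarrow> bool" (infix \<open>\<preceq>\<^sub>L\<close> 50) where
  "X \<preceq>\<^sub>L Y \<longleftrightarrow> pos_semidef (Y - X)"

(* The power operator inherited from the componentwise product on vec is not the matrix power. *)
primrec matpow :: "real^'n^'n \<Rightarrow> nat \<Rightarrow> real^'n^'n" where
  "matpow M 0 = mat 1"
| "matpow M (Suc k) = M ** matpow M k"

definition lyapunov_cond :: "nat \<Rightarrow> nat \<Rightarrow> (nat \<Rightarrow> real^'n^'n) \<Rightarrow> bool" where
  "lyapunov_cond N \<tau> A \<longleftrightarrow>
    (\<exists>P :: nat \<Rightarrow> real^'n^'n.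
      (\<forall>i\<in>{1..N}. 0 \<prec>\<^sub>L P i) \<and>
      (\<forall>i\<in>{1..N}. transpose (A i) ** P i ** A i - P i \<prec>\<^sub>L 0) \<and>
      (\<forall>i\<in>{1..N}. \<forall>j\<in>{1..N}. i \<noteq> j \<longrightarrow>
        matpow (transpose (A i)) \<tau> ** P i ** matpow (A i) \<tau> - P j \<prec>\<^sub>L 0))"

definition lifted_cond :: "nat \<Rightarrow> nat \<Rightarrow> (nat \<Rightarrow> real^'n^'n) \<Rightarrow> bool" where
  "lifted_cond N \<tau> A \<longleftrightarrow>
    (\<exists>(R :: nat \<Rightarrow> nat \<Rightarrow> real^'n^'n) (\<epsilon> :: real).
      \<epsilon> > 0 \<and>
      (\<forall>i\<in>{1..N}. \<forall>k\<in>{0..\<tau>}. transpose (R i k) = R i k) \<and>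
      (\<forall>i\<in>{1..N}. 0 \<prec>\<^sub>L R i 0) \<and>
      (\<forall>i\<in>{1..N}. transpose (A i) ** R i \<tau> ** A i - R i \<tau> \<prec>\<^sub>L 0) \<and>
      (\<forall>i\<in>{1..N}. \<forall>k\<in>{0..<\<tau>}. transpose (A i) ** R i (k + 1) ** A i - R i k \<preceq>\<^sub>L 0) \<and>
      (\<forall>i\<in>{1..N}. \<forall>j\<in>{1..N}. i \<noteq> j \<longrightarrow> R i 0 - R j \<tau> + \<epsilon> *\<^sub>R mat 1 \<preceq>\<^sub>L 0))"

definition dual_lifted_cond :: "nat \<Rightarrow> nat \<Rightarrow> (nat \<Rightarrow> real^'n^'n) \<Rightarrow> bool" where
  "dual_lifted_cond N \<tau> A \<longleftrightarrow>
    (\<exists>(S :: nat \<Rightarrow> nat \<Rightarrow> real^'n^'n) (\<epsilon> :: real).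
      \<epsilon> > 0 \<and>
      (\<forall>i\<in>{1..N}. \<forall>k\<in>{0..\<tau>}. transpose (S i k) = S i k) \<and>
      (\<forall>i\<in>{1..N}. 0 \<prec>\<^sub>L S i \<tau>) \<and>
      (\<forall>i\<in>{1..N}. A i ** S i \<tau> ** transpose (A i) - S i \<tau> \<prec>\<^sub>L 0) \<and>
      (\<forall>i\<in>{1..N}. \<forall>k\<in>{0..<\<tau>}. A i ** S i k ** transpose (A i) - S i (k + 1) \<preceq>\<^sub>L 0) \<and>
      (\<forall>i\<in>{1..N}. \<forall>j\<in>{1..N}. i \<noteq> j \<longrightarrow> S j \<tau> - S i 0 + \<epsilon> *\<^sub>R mat 1 \<preceq>\<^sub>L 0))"

(* The instants \<phi>_q, counted from \<phi>_0 = 0. If the signal switches only finitely often, the instants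
   beyond the last switch are \<infinity> (infimum of the empty set), and so are the dwell-times from the
   last switch on (in enat, \<infinity> - \<infinity> = \<infinity>). *)
primrec switching_instant :: "(nat \<Rightarrow> nat) \<Rightarrow> nat \<Rightarrow> enat" where
  "switching_instant \<sigma> 0 = 0"
| "switching_instant \<sigma> (Suc q) =
    Inf {enat t | t. switching_instant \<sigma> q < enat t \<and> \<sigma> t \<noteq> \<sigma> (t - 1)}"

definition dwell_time :: "(nat \<Rightarrow> nat) \<Rightarrow> nat \<Rightarrow> enat" where
  "dwell_time \<sigma> q = switching_instant \<sigma> (Suc q) - switching_instant \<sigma> q"

definition solution_from :: "(nat \<Rightarrow> real^'n^'n) \<Rightarrow> nat \<Rightarrow> (nat \<Rightarrow> real^'n) \<Rightarrow> bool" where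
  "solution_from M t\<^sub>0 x \<longleftrightarrow> (\<forall>t\<ge>t\<^sub>0. x (t + 1) = M t *v x t)"

(* Lyapunov stability of the origin and attraction of every solution, for every initial time. *)
definition asymptotically_stable :: "(nat \<Rightarrow> real^'n^'n) \<Rightarrow> bool" where
  "asymptotically_stable M \<longleftrightarrow>
    (\<forall>t\<^sub>0.
      (\<forall>e>0. \<exists>d>0. \<forall>x. solution_from M t\<^sub>0 x \<and> norm (x t\<^sub>0) < d \<longrightarrow> (\<forall>t\<ge>t\<^sub>0. norm (x t) < e)) \<and>
      (\<forall>x. solution_from M t\<^sub>0 x \<longrightarrow> x \<longlonglongrightarrow> 0))"

end

theory Submission
  imports Defs
begin

text \<open>
  Everything runs through one auxiliary family of matrices. Given the matrices \<open>P i\<close> of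
  condition (a), put
  \<open>R i k = (A\<^sub>i\<^sup>\<tau>\<^sup>-\<^sup>k)' P\<^sub>i A\<^sub>i\<^sup>\<tau>\<^sup>-\<^sup>k + \<delta> G\<^sub>i\<close>, where \<open>G\<^sub>i\<close> is the observability
  Gramian of \<open>A i\<close> over the horizon \<open>\<tau> - k\<close>. Then
  \<open>A\<^sub>i' R\<^sub>i(k+1) A\<^sub>i = R\<^sub>i(k) - \<delta> I\<close>, so the Gramian turns the sequence of congruences, which is only
  semidefinite when \<open>A i\<close> is singular, into one where all members are positive definite and all
  inequalities are strict; and for small \<open>\<delta>\<close> the inequality \<open>R\<^sub>i(0) \<prec> P\<^sub>j = R\<^sub>j(\<tau>)\<close> persists
  (\<open>strict_lift_exists\<close>).

  Such a strict family gives everything else. It satisfies (b), because finitely many strict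
  inequalities have a common margin \<open>\<epsilon>\<close>. The inverses \<open>S i k = (R i k)\<^sup>-\<^sup>1\<close> satisfy (c), because
  \<open>M' X M \<prec> Y\<close> implies \<open>M Y\<^sup>-\<^sup>1 M' \<prec> X\<^sup>-\<^sup>1\<close> (\<open>inverse_congruence_less\<close>). Finally,
  \<open>x' R\<^sub>i(k) x\<close>, with \<open>i\<close> the active mode and \<open>k\<close> the time since the last switch capped at \<open>\<tau>\<close>, is a
  Lyapunov function: the recursion makes it decrease while the mode ages, the inequality at \<open>\<tau>\<close> makes
  it decrease from then on, and at a switch, which the dwell-time bound allows only once \<open>k\<close> would
  reach \<open>\<tau>\<close>, the inequality \<open>R\<^sub>j(0) \<prec> R\<^sub>i(\<tau>)\<close> does.

  Conversely, iterating the recursions of (b) and (c) from one end of the horizon to the other leads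
  back to (a), with \<open>P\<^sub>i = R\<^sub>i(\<tau>)\<close> and \<open>P\<^sub>i = S\<^sub>i(\<tau>)\<^sup>-\<^sup>1\<close> respectively.
\<close>

section \<open>Quadratic forms and the Loewner order\<close>

definition quad_form :: "real^'n^'n \<Rightarrow> real^'n \<Rightarrow> real" where
  "quad_form X v = v \<bullet> (X *v v)"

lemma quad_form_zero [simp]: "quad_form X 0 = 0"
  by (simp add: quad_form_def)

lemma quad_form_add: "quad_form (X + Y) v = quad_form X v + quad_form Y v"
  by (simp add: quad_form_def matrix_vector_mult_add_rdistrib inner_add_right)

lemma quad_form_diff: "quad_form (X - Y) v = quad_form X v - quad_form Y v"
  by (simp add: quad_form_def matrix_vector_mult_diff_rdistrib inner_diff_right)

lemma quad_form_scaleR: "quad_form (c *\<^sub>R X) v = c * quad_form X v"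
  by (simp add: quad_form_def scaleR_matrix_vector_assoc [symmetric])

lemma quad_form_mat_1 [simp]: "quad_form (mat 1) v = (norm v)\<^sup>2"
  by (simp add: quad_form_def power2_norm_eq_inner)

lemma inner_matrix_vector: "v \<bullet> (M *v w) = (transpose M *v v) \<bullet> w"
  for M :: "real^'n^'m"
  by (metis dot_lmul_matrix transpose_matrix_vector)

lemma quad_form_congruence:
  "quad_form (transpose M ** X ** M) v = quad_form X (M *v v)"
  unfolding quad_form_def
  by (simp del: transpose_matrix_vector
      add: inner_matrix_vector matrix_vector_mul_assoc [symmetric])

lemma quad_form_congruence':
  "quad_form (M ** X ** transpose M) v = quad_form X (transpose M *v v)"
  using quad_form_congruence [of "transpose M"] by (simp del: transpose_matrix_vector)

lemma transpose_add: "transpose (X + Y) = transpose X + transpose (Y :: real^'n^'m)"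
  by (simp add: transpose_def vec_eq_iff)

lemma transpose_diff: "transpose (X - Y) = transpose X - transpose (Y :: real^'n^'m)"
  by (simp add: transpose_def vec_eq_iff)

lemma matrix_add_rdistrib: "(X + Y) ** Z = X ** Z + Y ** (Z :: real^'n^'m)"
  by (simp add: matrix_matrix_mult_def vec_eq_iff distrib_right sum.distrib)

lemma symmetric_congruence:
  fixes X :: "real^'n^'n"
  assumes "transpose X = X"
  shows "transpose (transpose M ** X ** M) = transpose M ** X ** M"
  using assms by (simp add: matrix_transpose_mul matrix_mul_assoc)

lemma symmetric_congruence':
  fixes X :: "real^'n^'n"
  assumes "transpose X = X"
  shows "transpose (M ** X ** transpose M) = M ** X ** transpose M"
  using assms by (simp add: matrix_transpose_mul matrix_mul_assoc)

lemma pos_def_iff: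
  "pos_def X \<longleftrightarrow> transpose X = X \<and> (\<forall>v. v \<noteq> 0 \<longrightarrow> 0 < quad_form X v)"
  by (simp add: pos_def_def quad_form_def)

lemma pos_semidef_iff:
  "pos_semidef X \<longleftrightarrow> transpose X = X \<and> (\<forall>v. 0 \<le> quad_form X v)"
  by (simp add: pos_semidef_def quad_form_def)

lemma quad_form_nonneg: "pos_def X \<Longrightarrow> 0 \<le> quad_form X v"
  by (cases "v = 0") (auto simp: pos_def_iff less_imp_le)

lemma zero_loewner_less [simp]: "0 \<prec>\<^sub>L X \<longleftrightarrow> pos_def X"
  by (simp add: loewner_less_def)

lemma diff_loewner_less_zero [simp]: "X - Y \<prec>\<^sub>L 0 \<longleftrightarrow> X \<prec>\<^sub>L Y"
  by (simp add: loewner_less_def)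

lemma diff_loewner_le_zero [simp]: "X - Y \<preceq>\<^sub>L 0 \<longleftrightarrow> X \<preceq>\<^sub>L Y"
  by (simp add: loewner_le_def)

lemma diff_add_loewner_le_zero [simp]: "X - Y + Z \<preceq>\<^sub>L 0 \<longleftrightarrow> X + Z \<preceq>\<^sub>L Y"
  by (simp add: loewner_le_def algebra_simps)

lemma loewner_less_iff:
  assumes "transpose X = X" "transpose Y = Y"
  shows "X \<prec>\<^sub>L Y \<longleftrightarrow> (\<forall>v. v \<noteq> 0 \<longrightarrow> quad_form X v < quad_form Y v)"
  using assms by (simp add: loewner_less_def pos_def_iff transpose_diff quad_form_diff)

lemma loewner_le_iff:
  assumes "transpose X = X" "transpose Y = Y"
  shows "X \<preceq>\<^sub>L Y \<longleftrightarrow> (\<forall>v. quad_form X v \<le> quad_form Y v)"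
  using assms by (simp add: loewner_le_def pos_semidef_iff transpose_diff quad_form_diff)

lemma loewner_lessD: "X \<prec>\<^sub>L Y \<Longrightarrow> v \<noteq> 0 \<Longrightarrow> quad_form X v < quad_form Y v"
  by (auto simp: loewner_less_def pos_def_iff quad_form_diff)

lemma loewner_leD: "X \<preceq>\<^sub>L Y \<Longrightarrow> quad_form X v \<le> quad_form Y v"
  by (auto simp: loewner_le_def pos_semidef_iff quad_form_diff dest: spec [of _ v])

lemma loewner_less_imp_le: "X \<prec>\<^sub>L Y \<Longrightarrow> X \<preceq>\<^sub>L Y"
  unfolding loewner_less_def loewner_le_def
  by (simp add: pos_semidef_iff quad_form_nonneg) (simp add: pos_def_iff)

section \<open>Uniform bounds for finite families of forms\<close>

lemma continuous_on_quad_form: "continuous_on S (quad_form X)"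
  unfolding quad_form_def
  by (intro continuous_intros matrix_vector_mult_linear_continuous_on)

text \<open>By homogeneity it is enough to look at the unit sphere, where the form attains its minimum.\<close>

lemma pos_def_margin:
  assumes "pos_def X"
  shows "\<exists>c>0. \<forall>v. c * (norm v)\<^sup>2 \<le> quad_form X v"
proof -
  have "\<exists>w\<in>sphere 0 1. \<forall>v\<in>sphere 0 1. quad_form X w \<le> quad_form X v"
    by (intro continuous_attains_inf continuous_on_quad_form) auto
  then obtain w where w: "norm w = 1" "\<And>v. norm v = 1 \<Longrightarrow> quad_form X w \<le> quad_form X v"
    by auto
  have "quad_form X w * (norm v)\<^sup>2 \<le> quad_form X v" for v
  proof (cases "v = 0")
    case False
    then have "quad_form X w \<le> quad_form X ((1 / norm v) *\<^sub>R v)"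
      by (intro w) simp
    also have "\<dots> = quad_form X v / (norm v)\<^sup>2"
      by (simp add: quad_form_def matrix_vector_mult_scaleR power2_eq_square)
    finally show ?thesis
      using False by (simp add: field_simps)
  qed simp
  moreover have "quad_form X w > 0"
    using assms w(1) unfolding pos_def_iff by (metis norm_zero zero_neq_one)
  ultimately show ?thesis by blast
qed

lemma pos_def_uniform_margin:
  assumes "finite I" "\<And>i. i \<in> I \<Longrightarrow> pos_def (X i)"
  shows "\<exists>c>0. \<forall>i\<in>I. \<forall>v. c * (norm v)\<^sup>2 \<le> quad_form (X i) v"
  using assms
proof (induction I rule: finite_induct)
  case empty
  show ?case by (auto intro: exI [of _ 1])
next
  case (insert a I)
  obtain c where c: "c > 0" "\<forall>i\<in>I. \<forall>v. c * (norm v)\<^sup>2 \<le> quad_form (X i) v"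
    using insert by auto
  obtain d where d: "d > 0" "\<forall>v. d * (norm v)\<^sup>2 \<le> quad_form (X a) v"
    using pos_def_margin insert.prems by blast
  have le: "min c d * (norm v)\<^sup>2 \<le> c * (norm v)\<^sup>2" "min c d * (norm v)\<^sup>2 \<le> d * (norm v)\<^sup>2" for v
    by (auto intro: mult_right_mono)
  show ?case
    using c d by (intro exI [of _ "min c d"]) (auto intro: order_trans [OF le(1)] order_trans [OF le(2)])
qed

lemma quad_form_uniform_bound:
  assumes "finite I"
  shows "\<exists>C>0. \<forall>i\<in>I. \<forall>v. quad_form (X i) v \<le> C * (norm v)\<^sup>2"
proof -
  define C where "C = 1 + (\<Sum>i\<in>I. onorm ((*v) (X i)))"
  have nonneg: "0 \<le> onorm ((*v) (X i))" for i
    by (simp add: onorm_pos_le)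
  have "quad_form (X i) v \<le> C * (norm v)\<^sup>2" if "i \<in> I" for i v
  proof -
    have "quad_form (X i) v \<le> norm v * norm (X i *v v)"
      unfolding quad_form_def by (rule norm_cauchy_schwarz)
    also have "\<dots> \<le> norm v * (onorm ((*v) (X i)) * norm v)"
      by (intro mult_left_mono onorm) auto
    also have "\<dots> = onorm ((*v) (X i)) * (norm v)\<^sup>2"
      by (simp add: power2_eq_square)
    also have "\<dots> \<le> C * (norm v)\<^sup>2"
      using member_le_sum [of i I "\<lambda>i. onorm ((*v) (X i))"] that assms nonneg
      by (intro mult_right_mono) (auto simp: C_def)
    finally show ?thesis .
  qed
  moreover have "C > 0"
    using nonneg by (simp add: C_def add_pos_nonneg sum_nonneg)
  ultimately show ?thesis by blast
qed

section \<open>Inverses of positive definite matrices\<close>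

lemma pos_def_matrix_inv:
  assumes "pos_def X"
  shows "X ** matrix_inv X = mat 1" "matrix_inv X ** X = mat 1"
proof -
  have "X *v v = 0 \<Longrightarrow> v = 0" for v
    using assms by (auto simp: pos_def_def)
  then have "\<exists>Y. Y ** X = mat 1"
    by (simp add: matrix_left_invertible_ker)
  then have "\<exists>Y. X ** Y = mat 1 \<and> Y ** X = mat 1"
    using matrix_left_right_inverse by blast
  from someI_ex [OF this]
  show "X ** matrix_inv X = mat 1" "matrix_inv X ** X = mat 1"
    by (simp_all add: matrix_inv_def)
qed

lemma symmetric_matrix_inv:
  assumes "pos_def X"
  shows "transpose (matrix_inv X) = matrix_inv X"
proof -
  have "transpose (matrix_inv X) ** X = transpose (X ** matrix_inv X)"
    using assms by (simp add: matrix_transpose_mul pos_def_iff)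
  then have "transpose (matrix_inv X) ** X = mat 1"
    by (simp add: pos_def_matrix_inv assms)
  then have "transpose (matrix_inv X) ** X ** matrix_inv X = matrix_inv X"
    by simp
  then show ?thesis
    by (simp add: matrix_mul_assoc [symmetric] pos_def_matrix_inv assms)
qed

lemma quad_form_matrix_inv:
  assumes "pos_def X"
  shows "quad_form (matrix_inv X) v = quad_form X (matrix_inv X *v v)"
  using assms
  by (simp add: quad_form_def matrix_vector_mul_assoc pos_def_matrix_inv inner_commute)

lemma pos_def_inverse:
  assumes "pos_def X"
  shows "pos_def (matrix_inv X)"
proof -
  have "matrix_inv X *v v = 0 \<Longrightarrow> v = 0" for v
    using pos_def_matrix_inv(1) [OF assms]
    by (metis matrix_vector_mul_assoc matrix_vector_mul_lid matrix_vector_mult_0_right)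
  then show ?thesis
    using assms unfolding pos_def_iff [of "matrix_inv X"]
    by (auto simp: symmetric_matrix_inv quad_form_matrix_inv) (auto simp: pos_def_iff)
qed

text \<open>
  With \<open>z = Y\<^sup>-\<^sup>1 M' w\<close> the vector \<open>X\<^sup>-\<^sup>1 w - M z\<close> has a nonnegative \<open>X\<close>-form; expanding it gives the
  claim, since the mixed term \<open>w \<bullet> M z = M' w \<bullet> z\<close> is the form of \<open>M Y\<^sup>-\<^sup>1 M'\<close> at \<open>w\<close>.
\<close>

lemma inverse_congruence_complete_square:
  assumes X: "pos_def X" and Y: "pos_def Y"
  shows "2 * quad_form (M ** matrix_inv Y ** transpose M) w
    \<le> quad_form (matrix_inv X) w
      + quad_form (transpose M ** X ** M) (matrix_inv Y *v (transpose M *v w))"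
proof -
  define z where "z = matrix_inv Y *v (transpose M *v w)"
  define a where "a = matrix_inv X *v w"
  have Xa: "X *v a = w"
    by (simp add: a_def matrix_vector_mul_assoc pos_def_matrix_inv X)
  have mixed: "quad_form (M ** matrix_inv Y ** transpose M) w = w \<bullet> (M *v z)"
    by (simp add: quad_form_def z_def matrix_vector_mul_assoc matrix_mul_assoc
        del: transpose_matrix_vector)
  have "a \<bullet> (X *v (M *v z)) = w \<bullet> (M *v z)"
    using X Xa by (metis inner_matrix_vector pos_def_iff)
  moreover have "0 \<le> quad_form X (a - M *v z)"
    by (rule quad_form_nonneg [OF X])
  ultimately have "2 * (w \<bullet> (M *v z)) \<le> quad_form X a + quad_form X (M *v z)"
    by (simp add: quad_form_def matrix_vector_mult_diff_distrib inner_diff_left inner_diff_right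
        Xa inner_commute)
  then show ?thesis
    unfolding mixed z_def [symmetric] quad_form_congruence quad_form_matrix_inv [OF X]
    by (simp add: a_def)
qed

lemma quad_form_inverse_congruence:
  assumes "pos_def Y"
  shows "quad_form (M ** matrix_inv Y ** transpose M) w
    = quad_form Y (matrix_inv Y *v (transpose M *v w))"
  by (simp add: quad_form_congruence' quad_form_matrix_inv assms del: transpose_matrix_vector)

lemma inverse_congruence_le:
  assumes X: "pos_def X" and Y: "pos_def Y" and le: "transpose M ** X ** M \<preceq>\<^sub>L Y"
  shows "M ** matrix_inv Y ** transpose M \<preceq>\<^sub>L matrix_inv X"
proof -
  have "quad_form (M ** matrix_inv Y ** transpose M) w \<le> quad_form (matrix_inv X) w" for w
    using inverse_congruence_complete_square [OF X Y, of M w]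
      quad_form_inverse_congruence [OF Y, of M w]
      loewner_leD [OF le, of "matrix_inv Y *v (transpose M *v w)"]
    by linarith
  then show ?thesis
    by (simp add: loewner_le_iff symmetric_congruence' symmetric_matrix_inv X Y)
qed

lemma inverse_congruence_less:
  assumes X: "pos_def X" and Y: "pos_def Y" and less: "transpose M ** X ** M \<prec>\<^sub>L Y"
  shows "M ** matrix_inv Y ** transpose M \<prec>\<^sub>L matrix_inv X"
proof -
  have "quad_form (M ** matrix_inv Y ** transpose M) w < quad_form (matrix_inv X) w"
    if "w \<noteq> 0" for w
  proof (cases "matrix_inv Y *v (transpose M *v w) = 0")
    case True
    then show ?thesis
      using quad_form_inverse_congruence [OF Y, of M w] pos_def_inverse [OF X] that
      by (simp add: pos_def_iff del: transpose_matrix_vector)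
  next
    case False
    then show ?thesis
      using inverse_congruence_complete_square [OF X Y, of M w]
        quad_form_inverse_congruence [OF Y, of M w] loewner_lessD [OF less False]
      by linarith
  qed
  then show ?thesis
    by (simp add: loewner_less_iff symmetric_congruence' symmetric_matrix_inv X Y)
qed

lemma inverse_antimono_less:
  assumes "pos_def X" "pos_def Y" "X \<prec>\<^sub>L Y"
  shows "matrix_inv Y \<prec>\<^sub>L matrix_inv X"
  using inverse_congruence_less [of X Y "mat 1"] assms by simp

section \<open>Matrix powers and Gramians\<close>

lemma matpow_Suc_right: "matpow M (Suc k) = matpow M k ** M"
  by (induction k) (simp_all add: matrix_mul_assoc)

lemma transpose_matpow: "transpose (matpow M k) = matpow (transpose M) k"
proof (induction k)
  case (Suc k)
  have "transpose (matpow M (Suc k)) = matpow (transpose M) k ** transpose M"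
    by (simp add: matrix_transpose_mul Suc)
  then show ?case
    by (simp only: matpow_Suc_right)
qed simp

text \<open>The observability Gramian of the pair of \<open>M\<close> and the identity, over \<open>m\<close> steps.\<close>

primrec gramian :: "real^'n^'n \<Rightarrow> nat \<Rightarrow> real^'n^'n" where
  "gramian M 0 = 0"
| "gramian M (Suc m) = transpose M ** gramian M m ** M + mat 1"

section \<open>Strict lifted families\<close>

text \<open>
  Compared with condition (b), all members are positive definite and the recursion is strict. This
  makes the family invertible term by term and lets its forms serve as Lyapunov functions.
\<close>

definition strict_lift ::
    "nat \<Rightarrow> nat \<Rightarrow> (nat \<Rightarrow> real^'n^'n) \<Rightarrow> (nat \<Rightarrow> nat \<Rightarrow> real^'n^'n) \<Rightarrow> bool" where
  "strict_lift N \<tau> A R \<longleftrightarrow>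
    (\<forall>i\<in>{1..N}. \<forall>k\<le>\<tau>. pos_def (R i k)) \<and>
    (\<forall>i\<in>{1..N}. transpose (A i) ** R i \<tau> ** A i \<prec>\<^sub>L R i \<tau>) \<and>
    (\<forall>i\<in>{1..N}. \<forall>k<\<tau>. transpose (A i) ** R i (Suc k) ** A i \<prec>\<^sub>L R i k) \<and>
    (\<forall>i\<in>{1..N}. \<forall>j\<in>{1..N}. i \<noteq> j \<longrightarrow> R i 0 \<prec>\<^sub>L R j \<tau>)"

text \<open>
  Run backwards from \<open>P\<close>, the Lyapunov recursion with right-hand side \<open>\<delta> I\<close> produces at step \<open>m\<close> the
  congruence of \<open>P\<close> with the \<open>m\<close>-th power plus \<open>\<delta>\<close> times the Gramian.
\<close>

lemma congruence_step_gramian: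
  "transpose M ** (matpow (transpose M) m ** P ** matpow M m + \<delta> *\<^sub>R gramian M m) ** M + \<delta> *\<^sub>R mat 1
    = matpow (transpose M) (Suc m) ** P ** matpow M (Suc m) + \<delta> *\<^sub>R gramian M (Suc m)"
proof -
  have "transpose M ** (\<delta> *\<^sub>R gramian M m) ** M = \<delta> *\<^sub>R (transpose M ** gramian M m ** M)"
    by (simp add: scalar_matrix_assoc matrix_scalar_ac)
  moreover have "matpow (transpose M) (Suc m) ** P ** matpow M (Suc m)
      = transpose M ** (matpow (transpose M) m ** P ** matpow M m) ** M"
    unfolding matpow_Suc_right [of M] by (simp add: matrix_mul_assoc)
  ultimately show ?thesis
    by (simp add: matrix_add_ldistrib matrix_add_rdistrib scaleR_add_right add.assoc)
qed

lemma strict_lift_exists: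
  fixes A :: "nat \<Rightarrow> real^'n^'n"
  assumes "lyapunov_cond N \<tau> A"
  shows "\<exists>R. strict_lift N \<tau> A R"
proof -
  from assms obtain P :: "nat \<Rightarrow> real^'n^'n" where
    P [rule_format]: "\<forall>i\<in>{1..N}. pos_def (P i)" and
    decr [rule_format]: "\<forall>i\<in>{1..N}. transpose (A i) ** P i ** A i \<prec>\<^sub>L P i" and
    jump [rule_format]: "\<forall>i\<in>{1..N}. \<forall>j\<in>{1..N}. i \<noteq> j \<longrightarrow>
      matpow (transpose (A i)) \<tau> ** P i ** matpow (A i) \<tau> \<prec>\<^sub>L P j"
    unfolding lyapunov_cond_def by - (elim exE conjE, rule that; simp)
  define Q where "Q = (\<lambda>i m. matpow (transpose (A i)) m ** P i ** matpow (A i) m)"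
  define D where "D = (\<lambda>(i, j). P j - Q i \<tau>)"
  define J where "J = {(i, j). i \<in> {1..N} \<and> j \<in> {1..N} \<and> i \<noteq> j}"
  have "finite J"
    by (rule finite_subset [of _ "{1..N} \<times> {1..N}"]) (auto simp: J_def)
  moreover have "pos_def (D p)" if "p \<in> J" for p
    using that jump by (auto simp: D_def J_def Q_def loewner_less_def)
  ultimately obtain c where c: "c > 0" "\<And>p v. p \<in> J \<Longrightarrow> c * (norm v)\<^sup>2 \<le> quad_form (D p) v"
    using pos_def_uniform_margin [of J D] by blast
  obtain C where C: "C > 0"
    "\<And>i v. i \<in> {1..N} \<Longrightarrow> quad_form (gramian (A i) \<tau>) v \<le> C * (norm v)\<^sup>2"
    using quad_form_uniform_bound [of "{1..N}" "\<lambda>i. gramian (A i) \<tau>"] by auto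
  \<comment> \<open>With this choice the perturbation uses up at most half of the margin at the switches.\<close>
  define \<delta> where "\<delta> = c / (2 * C)"
  have \<delta>: "\<delta> > 0" "\<delta> * C = c / 2"
    using c(1) C(1) by (auto simp: \<delta>_def)
  define L where "L = (\<lambda>i m. Q i m + \<delta> *\<^sub>R gramian (A i) m)"
  have L_0: "L i 0 = P i" for i
    by (simp add: L_def Q_def)
  have L_Suc: "L i (Suc m) = transpose (A i) ** L i m ** A i + \<delta> *\<^sub>R mat 1" for i m
    unfolding L_def Q_def by (rule congruence_step_gramian [symmetric])
  have pos: "pos_def (L i m)" if "i \<in> {1..N}" for i m
  proof (induction m)
    case 0
    show ?case using that P by (simp add: L_0)
  next
    case (Suc m)
    have "0 < quad_form (L i (Suc m)) v" if "v \<noteq> 0" for v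
      using quad_form_nonneg [OF Suc, of "A i *v v"] that \<delta>(1)
      by (simp add: L_Suc quad_form_add quad_form_scaleR quad_form_congruence add_nonneg_pos)
    moreover have "transpose (L i (Suc m)) = L i (Suc m)"
      using Suc by (simp add: L_Suc transpose_add transpose_scalar symmetric_congruence pos_def_iff)
    ultimately show ?case by (simp add: pos_def_iff)
  qed
  have step: "transpose (A i) ** L i m ** A i \<prec>\<^sub>L L i (Suc m)" for i m
    using \<delta>(1) by (simp add: L_Suc loewner_less_def pos_def_iff transpose_scalar quad_form_scaleR)
  have switch: "L i \<tau> \<prec>\<^sub>L P j" if ij: "i \<in> {1..N}" "j \<in> {1..N}" "i \<noteq> j" for i j
  proof -
    have "quad_form (L i \<tau>) v < quad_form (P j) v" if "v \<noteq> 0" for v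
    proof -
      have "c * (norm v)\<^sup>2 \<le> quad_form (P j) v - quad_form (Q i \<tau>) v"
        using c(2) [of "(i, j)" v] ij by (simp add: J_def D_def quad_form_diff)
      moreover have "\<delta> * quad_form (gramian (A i) \<tau>) v \<le> \<delta> * (C * (norm v)\<^sup>2)"
        using C(2) [OF ij(1)] \<delta>(1) by (intro mult_left_mono) auto
      moreover have "\<delta> * (C * (norm v)\<^sup>2) = c / 2 * (norm v)\<^sup>2"
        using \<delta>(2) by (simp add: mult.assoc [symmetric])
      moreover have "c / 2 * (norm v)\<^sup>2 < c * (norm v)\<^sup>2"
        using that c(1) by (intro mult_strict_right_mono) auto
      ultimately show ?thesis
        by (simp add: L_def quad_form_add quad_form_scaleR)
    qed
    moreover have "transpose (L i \<tau>) = L i \<tau>" "transpose (P j) = P j"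
      using pos P ij by (auto simp: pos_def_iff)
    ultimately show ?thesis
      by (simp add: loewner_less_iff)
  qed
  have "transpose (A i) ** L i (\<tau> - Suc k) ** A i \<prec>\<^sub>L L i (\<tau> - k)" if "k < \<tau>" for i k
    using step [of i "\<tau> - Suc k"] that by (simp add: Suc_diff_Suc)
  then have "strict_lift N \<tau> A (\<lambda>i k. L i (\<tau> - k))"
    unfolding strict_lift_def using pos decr switch by (simp add: L_0)
  then show ?thesis by blast
qed

text \<open>
  The scalar \<open>\<epsilon>\<close> of conditions (b) and (c): each positive definite difference dominates a multiple of
  the identity, and finiteness of the family lets one multiple serve for all.
\<close>

lemma loewner_less_uniform_margin:
  fixes X Y :: "'i \<Rightarrow> real^'n^'n"
  assumes "finite J" "\<And>p. p \<in> J \<Longrightarrow> X p \<prec>\<^sub>L Y p"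
  shows "\<exists>\<epsilon>>0. \<forall>p\<in>J. X p + \<epsilon> *\<^sub>R mat 1 \<preceq>\<^sub>L Y p"
proof -
  have pd: "\<And>p. p \<in> J \<Longrightarrow> pos_def (Y p - X p)"
    using assms(2) by (simp add: loewner_less_def)
  then obtain c where c: "c > 0" "\<And>p v. p \<in> J \<Longrightarrow> c * (norm v)\<^sup>2 \<le> quad_form (Y p - X p) v"
    using pos_def_uniform_margin [OF assms(1), of "\<lambda>p. Y p - X p"] by blast
  have "X p + c *\<^sub>R mat 1 \<preceq>\<^sub>L Y p" if "p \<in> J" for p
  proof -
    have eq: "Y p - (X p + c *\<^sub>R mat 1) = (Y p - X p) - c *\<^sub>R mat 1"
      by simp
    have "transpose (Y p - X p) = Y p - X p"
      using pd [OF that] by (simp add: pos_def_iff)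
    then show ?thesis
      using c(2) [OF that] unfolding loewner_le_def eq pos_semidef_iff
      by (simp add: transpose_diff [of "Y p - X p"] transpose_scalar
          quad_form_diff [of "Y p - X p"] quad_form_scaleR)
  qed
  then show ?thesis using c(1) by blast
qed

lemma loewner_less_uniform_margin_pairs:
  fixes X Y :: "nat \<Rightarrow> real^'n^'n"
  assumes "\<And>i j. i \<in> {1..N} \<Longrightarrow> j \<in> {1..N} \<Longrightarrow> i \<noteq> j \<Longrightarrow> X i \<prec>\<^sub>L Y j"
  shows "\<exists>\<epsilon>>0. \<forall>i\<in>{1..N}. \<forall>j\<in>{1..N}. i \<noteq> j \<longrightarrow> X i + \<epsilon> *\<^sub>R mat 1 \<preceq>\<^sub>L Y j"
proof -
  let ?J = "{(i, j). i \<in> {1..N} \<and> j \<in> {1..N} \<and> i \<noteq> j}"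
  have "finite ?J"
    by (rule finite_subset [of _ "{1..N} \<times> {1..N}"]) auto
  moreover have "X (fst p) \<prec>\<^sub>L Y (snd p)" if "p \<in> ?J" for p
    using that assms by (cases p) simp
  ultimately have "\<exists>\<epsilon>>0. \<forall>p\<in>?J. X (fst p) + \<epsilon> *\<^sub>R mat 1 \<preceq>\<^sub>L Y (snd p)"
    by (rule loewner_less_uniform_margin)
  then obtain \<epsilon> where "\<epsilon> > 0" "\<forall>p\<in>?J. X (fst p) + \<epsilon> *\<^sub>R mat 1 \<preceq>\<^sub>L Y (snd p)"
    by blast
  then show ?thesis by (intro exI [of _ \<epsilon>]) auto
qed

section \<open>Equivalence of the three conditions\<close>

lemma strict_lift_imp_lifted_cond:
  assumes "strict_lift N \<tau> A R"
  shows "lifted_cond N \<tau> A"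
proof -
  note R = assms [unfolded strict_lift_def]
  have "\<exists>\<epsilon>>0. \<forall>i\<in>{1..N}. \<forall>j\<in>{1..N}. i \<noteq> j \<longrightarrow> R i 0 + \<epsilon> *\<^sub>R mat 1 \<preceq>\<^sub>L R j \<tau>"
    by (rule loewner_less_uniform_margin_pairs) (use R in blast)
  then obtain \<epsilon> where \<epsilon>: "\<epsilon> > 0"
    "\<forall>i\<in>{1..N}. \<forall>j\<in>{1..N}. i \<noteq> j \<longrightarrow> R i 0 + \<epsilon> *\<^sub>R mat 1 \<preceq>\<^sub>L R j \<tau>"
    by blast
  have "transpose (R i k) = R i k" if "i \<in> {1..N}" "k \<le> \<tau>" for i k
    using that R by (simp add: pos_def_iff)
  with R \<epsilon> show ?thesis
    unfolding lifted_cond_def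
    by (intro exI [of _ R] exI [of _ \<epsilon>]) (simp add: loewner_less_imp_le)
qed

lemma strict_lift_imp_dual_lifted_cond:
  assumes "strict_lift N \<tau> A R"
  shows "dual_lifted_cond N \<tau> A"
proof -
  note R = assms [unfolded strict_lift_def]
  define S where "S = (\<lambda>i k. matrix_inv (R i k))"
  have pos: "pos_def (S i k)" if "i \<in> {1..N}" "k \<le> \<tau>" for i k
    using that R by (simp add: S_def pos_def_inverse)
  have decr: "A i ** S i \<tau> ** transpose (A i) \<prec>\<^sub>L S i \<tau>" if "i \<in> {1..N}" for i
    unfolding S_def using that R by (intro inverse_congruence_less) auto
  have step: "A i ** S i k ** transpose (A i) \<preceq>\<^sub>L S i (Suc k)" if "i \<in> {1..N}" "k < \<tau>" for i k
    unfolding S_def using that R by (intro inverse_congruence_le) (auto intro: loewner_less_imp_le)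
  have "S j \<tau> \<prec>\<^sub>L S i 0" if "j \<in> {1..N}" "i \<in> {1..N}" "j \<noteq> i" for i j
    unfolding S_def using that R by (intro inverse_antimono_less) auto
  then have "\<exists>\<epsilon>>0. \<forall>j\<in>{1..N}. \<forall>i\<in>{1..N}. j \<noteq> i \<longrightarrow> S j \<tau> + \<epsilon> *\<^sub>R mat 1 \<preceq>\<^sub>L S i 0"
    by (rule loewner_less_uniform_margin_pairs)
  then obtain \<epsilon> where \<epsilon>: "\<epsilon> > 0"
    "\<forall>j\<in>{1..N}. \<forall>i\<in>{1..N}. j \<noteq> i \<longrightarrow> S j \<tau> + \<epsilon> *\<^sub>R mat 1 \<preceq>\<^sub>L S i 0"
    by blast
  have "transpose (S i k) = S i k" if "i \<in> {1..N}" "k \<le> \<tau>" for i k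
    using pos [OF that] by (simp add: pos_def_iff)
  with pos decr step \<epsilon> show ?thesis
    unfolding dual_lifted_cond_def
    by (intro exI [of _ S] exI [of _ \<epsilon>]) simp
qed

lemma loewner_less_if_margin:
  assumes "X + \<epsilon> *\<^sub>R mat 1 \<preceq>\<^sub>L Y" "\<epsilon> > 0" "transpose X = X" "transpose Y = Y"
  shows "X \<prec>\<^sub>L Y"
proof -
  have "quad_form X v < quad_form Y v" if "v \<noteq> 0" for v
  proof -
    have "quad_form X v + \<epsilon> * (norm v)\<^sup>2 \<le> quad_form Y v"
      using loewner_leD [OF assms(1), of v] by (simp add: quad_form_add quad_form_scaleR)
    moreover have "\<epsilon> * (norm v)\<^sup>2 > 0"
      using that assms(2) by simp
    ultimately show ?thesis by linarith
  qed
  then show ?thesis using assms by (simp add: loewner_less_iff)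
qed

lemma pos_semidef_add_pos_def:
  assumes "pos_semidef X" "pos_def Y"
  shows "pos_def (X + Y)"
  using assms
  by (simp add: pos_def_iff pos_semidef_iff transpose_add quad_form_add add_nonneg_pos)

lemma loewner_le_less_trans:
  assumes "X \<preceq>\<^sub>L Y" "Y \<prec>\<^sub>L Z"
  shows "X \<prec>\<^sub>L Z"
  using pos_semidef_add_pos_def [of "Y - X" "Z - Y"] assms
  by (simp add: loewner_le_def loewner_less_def)

lemma pos_def_loewner_less_trans:
  assumes "pos_def X" "X \<prec>\<^sub>L Y"
  shows "pos_def Y"
  using loewner_le_less_trans [of 0 X Y] assms loewner_less_imp_le [of 0 X] by simp

lemma lifted_cond_imp_lyapunov_cond:
  fixes A :: "nat \<Rightarrow> real^'n^'n"
  assumes "N \<ge> 2" "lifted_cond N \<tau> A"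
  shows "lyapunov_cond N \<tau> A"
proof -
  from assms(2) obtain R :: "nat \<Rightarrow> nat \<Rightarrow> real^'n^'n" and \<epsilon> where
    \<epsilon>: "\<epsilon> > 0" and
    sym [rule_format]: "\<forall>i\<in>{1..N}. \<forall>k\<le>\<tau>. transpose (R i k) = R i k" and
    pos [rule_format]: "\<forall>i\<in>{1..N}. pos_def (R i 0)" and
    decr [rule_format]: "\<forall>i\<in>{1..N}. transpose (A i) ** R i \<tau> ** A i \<prec>\<^sub>L R i \<tau>" and
    step [rule_format]: "\<forall>i\<in>{1..N}. \<forall>k<\<tau>. transpose (A i) ** R i (k + 1) ** A i \<preceq>\<^sub>L R i k" and
    margin [rule_format]: "\<forall>i\<in>{1..N}. \<forall>j\<in>{1..N}. i \<noteq> j \<longrightarrow> R i 0 + \<epsilon> *\<^sub>R mat 1 \<preceq>\<^sub>L R j \<tau>"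
    unfolding lifted_cond_def by - (elim exE conjE, rule that; simp)
  have switch: "R i 0 \<prec>\<^sub>L R j \<tau>" if "i \<in> {1..N}" "j \<in> {1..N}" "i \<noteq> j" for i j
    using loewner_less_if_margin [OF margin \<epsilon>] that sym by simp
  have P: "pos_def (R j \<tau>)" if j: "j \<in> {1..N}" for j
  proof -
    \<comment> \<open>Positivity at the end of the horizon comes from the start of another mode's horizon.\<close>
    obtain i where i: "i \<in> {1..N}" "i \<noteq> j"
      using assms(1) by (intro that [of "if j = 1 then 2 else 1"]) auto
    then show ?thesis
      using pos_def_loewner_less_trans [OF pos switch] i j by simp
  qed
  have "quad_form (R i m) (matpow (A i) m *v v) \<le> quad_form (R i 0) v"
    if "i \<in> {1..N}" "m \<le> \<tau>" for i m v
    using that(2)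
  proof (induction m)
    case (Suc m)
    then show ?case
      using loewner_leD [OF step [OF that(1), of m], of "matpow (A i) m *v v"]
      by (simp add: quad_form_congruence matrix_vector_mul_assoc)
  qed simp
  then have iter: "matpow (transpose (A i)) \<tau> ** R i \<tau> ** matpow (A i) \<tau> \<preceq>\<^sub>L R i 0"
    if "i \<in> {1..N}" for i
    using that sym
    by (simp add: transpose_matpow [symmetric] loewner_le_iff symmetric_congruence
        quad_form_congruence)
  have "matpow (transpose (A i)) \<tau> ** R i \<tau> ** matpow (A i) \<tau> \<prec>\<^sub>L R j \<tau>"
    if "i \<in> {1..N}" "j \<in> {1..N}" "i \<noteq> j" for i j
    by (rule loewner_le_less_trans [OF iter switch]) (use that in auto)
  then show ?thesis
    unfolding lyapunov_cond_def using P decr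
    by (intro exI [of _ "\<lambda>i. R i \<tau>"]) simp
qed

text \<open>
  In the dual condition only the two ends of the horizon are known to be positive definite, which
  suffices: the recursion is first iterated over the whole horizon and only then inverted.
\<close>

lemma dual_lifted_cond_imp_lyapunov_cond:
  fixes A :: "nat \<Rightarrow> real^'n^'n"
  assumes "N \<ge> 2" "dual_lifted_cond N \<tau> A"
  shows "lyapunov_cond N \<tau> A"
proof -
  from assms(2) obtain S :: "nat \<Rightarrow> nat \<Rightarrow> real^'n^'n" and \<epsilon> where
    \<epsilon>: "\<epsilon> > 0" and
    sym [rule_format]: "\<forall>i\<in>{1..N}. \<forall>k\<le>\<tau>. transpose (S i k) = S i k" and
    pos [rule_format]: "\<forall>i\<in>{1..N}. pos_def (S i \<tau>)" and
    decr [rule_format]: "\<forall>i\<in>{1..N}. A i ** S i \<tau> ** transpose (A i) \<prec>\<^sub>L S i \<tau>" and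
    step [rule_format]: "\<forall>i\<in>{1..N}. \<forall>k<\<tau>. A i ** S i k ** transpose (A i) \<preceq>\<^sub>L S i (k + 1)" and
    margin [rule_format]: "\<forall>i\<in>{1..N}. \<forall>j\<in>{1..N}. i \<noteq> j \<longrightarrow> S j \<tau> + \<epsilon> *\<^sub>R mat 1 \<preceq>\<^sub>L S i 0"
    unfolding dual_lifted_cond_def by - (elim exE conjE, rule that; simp)
  have switch: "S j \<tau> \<prec>\<^sub>L S i 0" if "i \<in> {1..N}" "j \<in> {1..N}" "i \<noteq> j" for i j
    using loewner_less_if_margin [OF margin \<epsilon>] that sym by simp
  have pos0: "pos_def (S i 0)" if i: "i \<in> {1..N}" for i
  proof -
    obtain j where j: "j \<in> {1..N}" "i \<noteq> j"
      using assms(1) by (intro that [of "if i = 1 then 2 else 1"]) auto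
    then show ?thesis
      using pos_def_loewner_less_trans [OF pos switch] i j by simp
  qed
  define P where "P = (\<lambda>i. matrix_inv (S i \<tau>))"
  have P: "pos_def (P i)" if "i \<in> {1..N}" for i
    using that pos by (simp add: P_def pos_def_inverse)
  have P_decr: "transpose (A i) ** P i ** A i \<prec>\<^sub>L P i" if "i \<in> {1..N}" for i
    using inverse_congruence_less [of "S i \<tau>" "S i \<tau>" "transpose (A i)"] that pos decr
    by (simp add: P_def)
  have iter: "quad_form (S i 0) (matpow (transpose (A i)) m *v v) \<le> quad_form (S i m) v"
    if "i \<in> {1..N}" "m \<le> \<tau>" for i m v
    using that(2)
  proof (induction m arbitrary: v)
    case (Suc m)
    have "quad_form (S i 0) (matpow (transpose (A i)) (Suc m) *v v)
        = quad_form (S i 0) (matpow (transpose (A i)) m *v (transpose (A i) *v v))"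
      by (simp only: matpow_Suc_right matrix_vector_mul_assoc)
    also have "\<dots> \<le> quad_form (S i m) (transpose (A i) *v v)"
      using Suc by simp
    also have "\<dots> \<le> quad_form (S i (Suc m)) v"
      using loewner_leD [OF step [OF that(1), of m], of v] Suc.prems
      by (simp add: quad_form_congruence' del: transpose_matrix_vector)
    finally show ?case .
  qed simp
  have "matpow (transpose (A i)) \<tau> ** P i ** matpow (A i) \<tau> \<prec>\<^sub>L P j"
    if ij: "i \<in> {1..N}" "j \<in> {1..N}" "i \<noteq> j" for i j
  proof -
    let ?M = "matpow (transpose (A i)) \<tau>"
    have "transpose ?M ** S i 0 ** ?M \<preceq>\<^sub>L S i \<tau>"
      using iter [OF ij(1), of \<tau>] sym ij(1)
      by (simp add: loewner_le_iff symmetric_congruence quad_form_congruence)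
    then have "?M ** P i ** transpose ?M \<preceq>\<^sub>L matrix_inv (S i 0)"
      unfolding P_def using pos0 pos ij by (intro inverse_congruence_le) auto
    moreover have "matrix_inv (S i 0) \<prec>\<^sub>L P j"
      unfolding P_def using pos0 pos switch ij by (intro inverse_antimono_less) auto
    ultimately show ?thesis
      by (simp add: transpose_matpow loewner_le_less_trans)
  qed
  then show ?thesis
    unfolding lyapunov_cond_def using P P_decr by (intro exI [of _ P]) simp
qed

section \<open>Stability under the dwell-time constraint\<close>

text \<open>
  The steps since the last switch; starting from \<open>0\<close> agrees with counting time \<open>0\<close> as the first
  switching instant. The cap makes the pair of mode and age range over a finite set.
\<close>

primrec mode_age :: "(nat \<Rightarrow> nat) \<Rightarrow> nat \<Rightarrow> nat \<Rightarrow> nat" where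
  "mode_age \<sigma> \<tau> 0 = 0"
| "mode_age \<sigma> \<tau> (Suc t) = (if \<sigma> (Suc t) \<noteq> \<sigma> t then 0 else min \<tau> (Suc (mode_age \<sigma> \<tau> t)))"

lemma mode_age_le: "mode_age \<sigma> \<tau> t \<le> \<tau>"
  by (cases t) auto

lemma switching_instant_Suc_eq:
  assumes "switching_instant \<sigma> q = enat p" "p \<le> t"
    and const: "\<And>s. p < s \<Longrightarrow> s \<le> t \<Longrightarrow> \<sigma> s = \<sigma> (s - 1)"
    and switch: "\<sigma> (Suc t) \<noteq> \<sigma> t"
  shows "switching_instant \<sigma> (Suc q) = enat (Suc t)"
proof -
  let ?T = "{enat s | s. enat p < enat s \<and> \<sigma> s \<noteq> \<sigma> (s - 1)}"
  have "enat (Suc t) \<in> ?T"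
    using assms by auto
  moreover have "enat (Suc t) \<le> e" if T: "e \<in> ?T" for e
  proof -
    obtain s where s: "e = enat s" "p < s" "\<sigma> s \<noteq> \<sigma> (s - 1)"
      using T by auto
    then have "\<not> s \<le> t" using const by blast
    then show ?thesis using s(1) by simp
  qed
  ultimately have "Inf ?T = enat (Suc t)"
    by (intro antisym Inf_lower Inf_greatest)
  then show ?thesis using assms(1) by simp
qed

text \<open>
  The age is defined by recursion on time, whereas the dwell-times come from infima over future
  switches. The two views meet in the latest switching instant \<open>p\<close> up to time \<open>t\<close>.
\<close>

lemma mode_age_since_last_switch:
  "\<exists>q p. switching_instant \<sigma> q = enat p \<and> p \<le> t \<and> mode_age \<sigma> \<tau> t = min \<tau> (t - p)
    \<and> (\<forall>s. p < s \<longrightarrow> s \<le> t \<longrightarrow> \<sigma> s = \<sigma> (s - 1))"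
proof (induction t)
  case 0
  show ?case
    by (intro exI [of _ 0]) (simp add: zero_enat_def)
next
  case (Suc t)
  then obtain q p where qp: "switching_instant \<sigma> q = enat p" "p \<le> t"
    "mode_age \<sigma> \<tau> t = min \<tau> (t - p)"
    "\<And>s. p < s \<Longrightarrow> s \<le> t \<Longrightarrow> \<sigma> s = \<sigma> (s - 1)"
    by blast
  show ?case
  proof (cases "\<sigma> (Suc t) = \<sigma> t")
    case True
    then show ?thesis
      using qp by (intro exI [of _ q] exI [of _ p]) (auto simp: le_Suc_eq Suc_diff_le)
  next
    case False
    then show ?thesis
      using switching_instant_Suc_eq [OF qp(1,2,4) False]
      by (intro exI [of _ "Suc q"] exI [of _ "Suc t"]) auto
  qed
qed

lemma mode_age_at_switch:
  assumes dwell: "\<And>q. enat \<tau> \<le> dwell_time \<sigma> q" and switch: "\<sigma> (Suc t) \<noteq> \<sigma> t"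
  shows "\<tau> \<le> Suc (mode_age \<sigma> \<tau> t)"
proof -
  obtain q p where qp: "switching_instant \<sigma> q = enat p" "p \<le> t"
    "mode_age \<sigma> \<tau> t = min \<tau> (t - p)"
    "\<And>s. p < s \<Longrightarrow> s \<le> t \<Longrightarrow> \<sigma> s = \<sigma> (s - 1)"
    using mode_age_since_last_switch by blast
  have "switching_instant \<sigma> (Suc q) = enat (Suc t)"
    by (rule switching_instant_Suc_eq [OF qp(1,2,4) switch])
  then have "dwell_time \<sigma> q = enat (Suc t - p)"
    by (simp add: dwell_time_def qp(1) del: switching_instant.simps(2))
  then show ?thesis
    using dwell [of q] qp(2,3) by auto
qed

text \<open>
  Along a solution \<open>V\<close> decreases, so the sandwich bounds give stability; being nonnegative it also
  converges, so its decrements tend to zero, and these dominate the squared norm of the state.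
\<close>

lemma asymptotically_stable_if_lyapunov_function:
  fixes M :: "nat \<Rightarrow> real^'n^'n" and V :: "nat \<Rightarrow> real^'n \<Rightarrow> real"
  assumes c: "c > 0" and d: "d > 0" and C: "C > 0"
    and lower: "\<And>t v. c * (norm v)\<^sup>2 \<le> V t v"
    and upper: "\<And>t v. V t v \<le> C * (norm v)\<^sup>2"
    and decr: "\<And>t v. V (Suc t) (M t *v v) + d * (norm v)\<^sup>2 \<le> V t v"
  shows "asymptotically_stable M"
proof -
  have descent: "V (Suc t) (x (Suc t)) + d * (norm (x t))\<^sup>2 \<le> V t (x t)"
    if "solution_from M t\<^sub>0 x" "t \<ge> t\<^sub>0" for t\<^sub>0 x t
    using decr [of t "x t"] that by (simp add: solution_from_def)
  have mono: "V t (x t) \<le> V t\<^sub>0 (x t\<^sub>0)" if "solution_from M t\<^sub>0 x" "t \<ge> t\<^sub>0" for t\<^sub>0 x t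
    using that(2)
  proof (induction t rule: dec_induct)
    case (step t)
    moreover have "0 \<le> d * (norm (x t))\<^sup>2" using d by simp
    ultimately show ?case using descent [OF that(1), of t] by linarith
  qed simp
  have stable: "\<exists>\<delta>>0. \<forall>x. solution_from M t\<^sub>0 x \<and> norm (x t\<^sub>0) < \<delta> \<longrightarrow> (\<forall>t\<ge>t\<^sub>0. norm (x t) < e)"
    if e: "e > 0" for t\<^sub>0 and e :: real
  proof -
    define \<delta> where "\<delta> = sqrt (c / C) * e"
    have "norm (x t) < e" if x: "solution_from M t\<^sub>0 x" "norm (x t\<^sub>0) < \<delta>" "t \<ge> t\<^sub>0" for x t
    proof -
      have "c * (norm (x t))\<^sup>2 \<le> C * (norm (x t\<^sub>0))\<^sup>2"
        using lower [of "x t" t] mono [OF x(1,3)] upper [of t\<^sub>0 "x t\<^sub>0"] by linarith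
      also have "\<dots> < C * \<delta>\<^sup>2"
        using x(2) C by (intro mult_strict_left_mono power_strict_mono) auto
      also have "\<dots> = c * e\<^sup>2"
        using c C by (simp add: \<delta>_def power_mult_distrib)
      finally have "(norm (x t))\<^sup>2 < e\<^sup>2"
        using c by simp
      then show ?thesis
        using e by (simp add: power2_less_imp_less)
    qed
    moreover have "\<delta> > 0" using c C e by (simp add: \<delta>_def)
    ultimately show ?thesis by blast
  qed
  have attractive: "x \<longlonglongrightarrow> 0" if x: "solution_from M t\<^sub>0 x" for t\<^sub>0 x
  proof -
    define f where "f = (\<lambda>n. V (n + t\<^sub>0) (x (n + t\<^sub>0)))"
    have f_step: "f (Suc n) + d * (norm (x (n + t\<^sub>0)))\<^sup>2 \<le> f n" for n
      using descent [OF x, of "n + t\<^sub>0"] by (simp add: f_def)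
    have "decseq f"
    proof (rule decseq_SucI)
      fix n
      have "0 \<le> d * (norm (x (n + t\<^sub>0)))\<^sup>2" using d by simp
      then show "f (Suc n) \<le> f n" using f_step [of n] by linarith
    qed
    moreover have "0 \<le> f n" for n
      using lower [of "x (n + t\<^sub>0)" "n + t\<^sub>0"] c unfolding f_def
      by (meson order_trans mult_nonneg_nonneg less_imp_le zero_le_power2)
    ultimately obtain l where l: "f \<longlonglongrightarrow> l"
      using decseq_convergent by blast
    have "(\<lambda>n. (f n - f (Suc n)) / d) \<longlonglongrightarrow> (l - l) / d"
      using d by (intro tendsto_intros l LIMSEQ_Suc) auto
    then have "(\<lambda>n. (f n - f (Suc n)) / d) \<longlonglongrightarrow> 0" by simp
    then have "(\<lambda>n. (norm (x (n + t\<^sub>0)))\<^sup>2) \<longlonglongrightarrow> 0"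
    proof (rule Lim_null_comparison [rotated])
      show "\<forall>\<^sub>F n in sequentially. norm ((norm (x (n + t\<^sub>0)))\<^sup>2) \<le> (f n - f (Suc n)) / d"
        using f_step d by (intro always_eventually allI) (simp add: field_simps)
    qed
    then have "(\<lambda>n. sqrt ((norm (x (n + t\<^sub>0)))\<^sup>2)) \<longlonglongrightarrow> sqrt 0"
      by (rule tendsto_real_sqrt)
    then have "(\<lambda>n. x (n + t\<^sub>0)) \<longlonglongrightarrow> 0"
      by (simp add: tendsto_norm_zero_iff)
    then show ?thesis by (rule LIMSEQ_offset)
  qed
  show ?thesis
    unfolding asymptotically_stable_def using stable attractive by blast
qed

text \<open>
  The decrease over a step taken in mode \<open>i\<close> at age \<open>k\<close> is governed by one of finitely many
  inequalities of the strict family, and a switch only lowers the form further. The decrease is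
  therefore uniform in time.
\<close>

lemma strict_lift_imp_asymptotically_stable:
  fixes A :: "nat \<Rightarrow> real^'n^'n"
  assumes lift: "strict_lift N \<tau> A R"
    and \<sigma>: "\<And>t. \<sigma> t \<in> {1..N}" and dwell: "\<And>q. enat \<tau> \<le> dwell_time \<sigma> q"
  shows "asymptotically_stable (\<lambda>t. A (\<sigma> t))"
proof -
  note R = lift [unfolded strict_lift_def]
  let ?I = "{1..N} \<times> {..\<tau>}"
  have fin: "finite ?I" by simp
  define D where "D = (\<lambda>(i, k). R i k - transpose (A i) ** R i (min \<tau> (Suc k)) ** A i)"
  have "pos_def (D p)" if "p \<in> ?I" for p
  proof -
    obtain i k where p: "p = (i, k)" "i \<in> {1..N}" "k \<le> \<tau>"
      using \<open>p \<in> ?I\<close> by auto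
    show ?thesis
    proof (cases "k = \<tau>")
      case True
      then show ?thesis using R p by (simp add: D_def loewner_less_def)
    next
      case False
      then have "k < \<tau>" "min \<tau> (Suc k) = Suc k" using p by auto
      then show ?thesis using R p by (simp add: D_def loewner_less_def)
    qed
  qed
  then obtain d where d: "d > 0" "\<And>p v. p \<in> ?I \<Longrightarrow> d * (norm v)\<^sup>2 \<le> quad_form (D p) v"
    using pos_def_uniform_margin [of ?I D] fin by blast
  have "pos_def (case p of (i, k) \<Rightarrow> R i k)" if "p \<in> ?I" for p
    using that R by auto
  then obtain c where c: "c > 0"
    "\<And>p v. p \<in> ?I \<Longrightarrow> c * (norm v)\<^sup>2 \<le> quad_form (case p of (i, k) \<Rightarrow> R i k) v"
    using pos_def_uniform_margin [of ?I "\<lambda>(i, k). R i k"] fin by blast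
  obtain C where C: "C > 0"
    "\<forall>p\<in>?I. \<forall>v. quad_form (case p of (i, k) \<Rightarrow> R i k) v \<le> C * (norm v)\<^sup>2"
    using quad_form_uniform_bound [of ?I "\<lambda>(i, k). R i k"] by auto
  define V where "V = (\<lambda>t. quad_form (R (\<sigma> t) (mode_age \<sigma> \<tau> t)))"
  have mem: "(\<sigma> t, mode_age \<sigma> \<tau> t) \<in> ?I" for t
    using \<sigma> mode_age_le by auto
  show ?thesis
  proof (rule asymptotically_stable_if_lyapunov_function [OF c(1) d(1) C(1)])
    fix t v
    show "c * (norm v)\<^sup>2 \<le> V t v"
      using c(2) [OF mem [of t], of v] by (simp add: V_def)
    show "V t v \<le> C * (norm v)\<^sup>2"
      using C(2) mem [of t] by (auto simp: V_def)
    let ?i = "\<sigma> t" and ?k = "mode_age \<sigma> \<tau> t"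
    let ?w = "A ?i *v v"
    have "V (Suc t) ?w \<le> quad_form (R ?i (min \<tau> (Suc ?k))) ?w"
    proof (cases "\<sigma> (Suc t) = ?i")
      case False
      then have "R (\<sigma> (Suc t)) 0 \<prec>\<^sub>L R ?i \<tau>"
        using R \<sigma> by blast
      \<comment> \<open>The dwell-time bound enters here: the old mode is left only at full age.\<close>
      moreover have "min \<tau> (Suc ?k) = \<tau>"
        using mode_age_at_switch [OF dwell False] by simp
      ultimately show ?thesis
        using False by (simp add: V_def loewner_leD loewner_less_imp_le)
    qed (simp add: V_def)
    moreover have "quad_form (R ?i (min \<tau> (Suc ?k))) ?w + d * (norm v)\<^sup>2 \<le> V t v"
      using d(2) [OF mem [of t], of v]
      by (simp add: D_def V_def quad_form_diff quad_form_congruence)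
    ultimately show "V (Suc t) ?w + d * (norm v)\<^sup>2 \<le> V t v"
      by linarith
  qed
qed

section \<open>The equivalence theorem\<close>

theorem theorem3p1:
  fixes A :: "nat \<Rightarrow> real^'n^'n" and N \<tau> :: nat
  assumes "N \<ge> 2" and "\<tau> \<ge> 1"
  shows "(lyapunov_cond N \<tau> A \<longleftrightarrow> lifted_cond N \<tau> A) \<and>
         (lifted_cond N \<tau> A \<longleftrightarrow> dual_lifted_cond N \<tau> A) \<and>
         (lyapunov_cond N \<tau> A \<or> lifted_cond N \<tau> A \<or> dual_lifted_cond N \<tau> A \<longrightarrow>
           (\<forall>\<sigma>. (\<forall>t. \<sigma> t \<in> {1..N}) \<and> (\<forall>q. dwell_time \<sigma> q \<ge> enat \<tau>) \<longrightarrow>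
             asymptotically_stable (\<lambda>t. A (\<sigma> t))))"
proof -
  have "lyapunov_cond N \<tau> A \<longleftrightarrow> lifted_cond N \<tau> A"
    using strict_lift_exists strict_lift_imp_lifted_cond lifted_cond_imp_lyapunov_cond assms(1)
    by blast
  moreover have "lyapunov_cond N \<tau> A \<longleftrightarrow> dual_lifted_cond N \<tau> A"
    using strict_lift_exists strict_lift_imp_dual_lifted_cond
      dual_lifted_cond_imp_lyapunov_cond assms(1)
    by blast
  moreover have "asymptotically_stable (\<lambda>t. A (\<sigma> t))"
    if "lyapunov_cond N \<tau> A" "\<forall>t. \<sigma> t \<in> {1..N}" "\<forall>q. dwell_time \<sigma> q \<ge> enat \<tau>" for \<sigma>
    using strict_lift_exists [OF that(1)] strict_lift_imp_asymptotically_stable that by blast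
  ultimately show ?thesis by blast
qed

end
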